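(* Let $P,Q$ be proper upward monotone quantifiers on a nonempty set $D$ and let $\kappa$ be an infinite cardinal. (1) If $P$ is $\kappa$-small and $Q$ is $\kappa$-complete, then $P\cdot Q=P\boxtimes Q$. (2) If $Q^d$ is $\kappa$-small and $P^d$ is $\kappa$-complete, then $Q^d\cdot P^d=Q^d\boxtimes P^d$. (3) If $Q$ is $\operatorname{cf}(\lambda)$-chain-complete for every cardinal $\lambda$ with $\kappa\leq\lambda\leq|D|$, and $P^d$ is $\kappa$-complete, then $Q^d\cdot P^d=Q^d\boxtimes P^d$. (4) If $P^d$ is $\operatorname{cf}(\lambda)$-chain-complete for every cardinal $\lambda$ with $\kappa\leq\lambda\leq|D|$, and $Q$ is $\kappa$-complete, then $P\cdot Q=P\boxtimes Q$.
   Context: A (unary) quantifier on a nonempty set $D$ is a family $Q\subseteq\mathcal P(D)$. It is upward monotone if $A\in Q$ and $A\subseteq B\subseteq D$ imply $B\in Q$; it is proper if $\varnothing\notin Q$ and $D\in Q$. For an infinite cardinal $\kappa$: $Q$ is $\kappa$-complete if every intersection of fewer than $\kappa$ members of $Q$ belongs to $Q$; $Q$ is $\kappa$-chain-complete if $\bigcap_{\alpha<\kappa}X_\alpha\in Q$ for every descending chain $(X_\alpha)_{\alpha<\kappa}$ in $Q$ (i.e. $X_\beta\subseteq X_\alpha$ whenever $\alpha\leq\beta<\kappa$); $Q$ is $\kappa$-small if every $A\in Q$ has a subset $B\in Q$ with $|B|<\kappa$. $\operatorname{cf}$ denotes cofinality. The dual is $Q^d=\{A\subseteq D:D\setminus A\notin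 Q\}$. For $R\subseteq D^2$ put $R_x=\{y\in D:(x,y)\in R\}$. The iteration is $P\cdot Q=\{R\subseteq D^2:\{x\in D:R_x\in Q\}\in P\}$. The branching product is $P\boxtimes Q=\{R\subseteq D^2:\exists A\in P\ \exists B\in Q\ (A\times B\subseteq R)\}$. *)

theory Defs
  imports Main
begin

unbundle cardinal_syntax

text \<open>
  A cardinal is a relation \<open>r\<close> with \<open>Card_order r\<close>, i.e. a well-order of minimal order type
  on its field; \<open>Cinfinite r\<close> says that it is infinite. The elements of \<open>Field r\<close> play the role
  of the ordinals below the cardinal, and \<open>(\<alpha>, \<beta>) \<in> r\<close> that of \<open>\<alpha> \<le> \<beta>\<close>.
  Every cardinal \<open>\<le>o |D|\<close> with \<open>D :: 'a set\<close> is order isomorphic to some \<open>\<mu> :: 'a rel\<close>, so that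
  quantifying over \<open>\<mu> :: 'a rel\<close> covers all cardinals up to \<open>|D|\<close>.
\<close>

definition quantifier_on :: "'a set \<Rightarrow> 'a set set \<Rightarrow> bool" where
  "quantifier_on D Q \<longleftrightarrow> Q \<subseteq> Pow D"

definition upward_monotone_on :: "'a set \<Rightarrow> 'a set set \<Rightarrow> bool" where
  "upward_monotone_on D Q \<longleftrightarrow> (\<forall>A B. A \<in> Q \<and> A \<subseteq> B \<and> B \<subseteq> D \<longrightarrow> B \<in> Q)"

definition proper_on :: "'a set \<Rightarrow> 'a set set \<Rightarrow> bool" where
  "proper_on D Q \<longleftrightarrow> {} \<notin> Q \<and> D \<in> Q"

text \<open>Intersecting with \<open>D\<close> makes the empty intersection equal to \<open>D\<close> rather than \<open>UNIV\<close>.\<close>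

definition complete_on :: "'a set \<Rightarrow> 'k rel \<Rightarrow> 'a set set \<Rightarrow> bool" where
  "complete_on D \<kappa> Q \<longleftrightarrow> (\<forall>S. S \<subseteq> Q \<and> |S| <o \<kappa> \<longrightarrow> D \<inter> \<Inter>S \<in> Q)"

definition chain_complete :: "'k rel \<Rightarrow> 'a set set \<Rightarrow> bool" where
  "chain_complete \<kappa> Q \<longleftrightarrow>
     (\<forall>X. (\<forall>\<alpha> \<in> Field \<kappa>. X \<alpha> \<in> Q) \<and> (\<forall>\<alpha> \<beta>. (\<alpha>, \<beta>) \<in> \<kappa> \<longrightarrow> X \<beta> \<subseteq> X \<alpha>)
        \<longrightarrow> (\<Inter>\<alpha> \<in> Field \<kappa>. X \<alpha>) \<in> Q)"

definition small :: "'k rel \<Rightarrow> 'a set set \<Rightarrow> bool" where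
  "small \<kappa> Q \<longleftrightarrow> (\<forall>A \<in> Q. \<exists>B \<in> Q. B \<subseteq> A \<and> |B| <o \<kappa>)"

text \<open>
  The least cardinality of a cofinal subset. The library's \<^const>\<open>cofinal\<close> is strict
  (every element lies strictly below one of the subset), so the definition is meaningful only
  for orders without a maximum, in particular for infinite cardinals. The choice of the
  witness affects the result only up to order isomorphism.
\<close>

definition cofinality :: "'a rel \<Rightarrow> 'a rel" where
  "cofinality r = |SOME A. A \<subseteq> Field r \<and> cofinal A r \<and>
     (\<forall>B. B \<subseteq> Field r \<and> cofinal B r \<longrightarrow> |A| \<le>o |B| )|"

lemma cofinality_witness:
  assumes "Cinfinite r"
  obtains A where "A \<subseteq> Field r" "cofinal A r" "cofinality r = |A|"
    "\<And>B. B \<subseteq> Field r \<Longrightarrow> cofinal B r \<Longrightarrow> |A| \<le>o |B|"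
proof -
  let ?R = "card_of ` {A. A \<subseteq> Field r \<and> cofinal A r}"
  let ?P = "\<lambda>A. A \<subseteq> Field r \<and> cofinal A r \<and>
    (\<forall>B. B \<subseteq> Field r \<and> cofinal B r \<longrightarrow> |A| \<le>o |B| )"
  have "cofinal (Field r) r"
    unfolding cofinal_def
    using infinite_Card_order_limit[of r] assms by (fastforce simp: cinfinite_def)
  then have "?R \<noteq> {}" by blast
  moreover have "\<forall>s \<in> ?R. Card_order s" by (auto simp: card_of_Card_order)
  ultimately have "\<exists>s \<in> ?R. \<forall>s' \<in> ?R. s \<le>o s'" by (rule exists_minim_Card_order)
  then have "\<exists>A. ?P A" by blast
  then have "?P (SOME A. ?P A)" by (rule someI_ex)
  then show thesis using that by (auto simp: cofinality_def)
qed

definition dual_on :: "'a set \<Rightarrow> 'a set set \<Rightarrow> 'a set set" where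
  "dual_on D Q = {A. A \<subseteq> D \<and> D - A \<notin> Q}"

definition section_at :: "'a set \<Rightarrow> 'a rel \<Rightarrow> 'a \<Rightarrow> 'a set" where
  "section_at D R x = {y \<in> D. (x, y) \<in> R}"

definition iteration_on :: "'a set \<Rightarrow> 'a set set \<Rightarrow> 'a set set \<Rightarrow> 'a rel set" where
  "iteration_on D P Q = {R. R \<subseteq> D \<times> D \<and> {x \<in> D. section_at D R x \<in> Q} \<in> P}"

definition branching_on :: "'a set \<Rightarrow> 'a set set \<Rightarrow> 'a set set \<Rightarrow> 'a rel set" where
  "branching_on D P Q = {R. R \<subseteq> D \<times> D \<and> (\<exists>A \<in> P. \<exists>B \<in> Q. A \<times> B \<subseteq> R)}"

end

theory Submission
  imports Defs
begin

text \<open>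
  An element \<open>R\<close> of the iteration always has a large set of points \<open>x\<close> with large sections
  \<open>R\<^sub>x\<close>. When the outer quantifier is \<open>\<kappa>\<close>-small, that set can be shrunk to one of
  cardinality below \<open>\<kappa>\<close>, and \<open>\<kappa>\<close>-completeness of the inner quantifier then makes the
  intersection of the remaining sections large. This intersection is the second side of a
  rectangle inside \<open>R\<close> (\<open>iteration_eq_branching\<close>). The
  converse inclusion is monotonicity alone.

  This settles the two parts that assume smallness. The two others reduce to them, because
  chain-completeness at the cofinalities of all \<open>\<lambda>\<close> between \<open>\<kappa>\<close> and \<open>|D|\<close> makes the dual
  \<open>\<kappa>\<close>-small (\<open>small_dual_if_chain_complete\<close>). Suppose the dual has a member none of whose
  subsets in the dual has cardinality below \<open>\<kappa>\<close>, and take among these subsets a \<open>B\<close> of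
  least cardinality \<open>\<lambda> \<ge> \<kappa>\<close>. Then \<open>B\<close> is the union of an increasing chain
  of length \<open>cf(\<lambda>)\<close> of sets of cardinality below \<open>\<lambda>\<close>. By minimality none of these sets is in
  the dual, so that their complements form a descending chain in the quantifier. Its
  intersection is the complement of \<open>B\<close>, which contradicts that \<open>B\<close> is in the dual.
  Applied to \<open>Q\<close> this makes \<open>Q\<^sup>d\<close> small, and applied to \<open>P\<^sup>d\<close> it makes \<open>P\<close> itself small,
  because the dual is an involution.
\<close>

lemma quantifier_on_dual: "quantifier_on D (dual_on D Q)"
  by (auto simp: quantifier_on_def dual_on_def)

lemma upward_monotone_on_dual:
  assumes "upward_monotone_on D Q"
  shows "upward_monotone_on D (dual_on D Q)"
  unfolding upward_monotone_on_def
proof (intro allI impI, elim conjE)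
  fix A B
  assume A: "A \<in> dual_on D Q" and "A \<subseteq> B" "B \<subseteq> D"
  then have "D - B \<subseteq> D - A" "D - A \<subseteq> D"
    by auto
  with assms have "D - B \<in> Q \<Longrightarrow> D - A \<in> Q"
    unfolding upward_monotone_on_def by blast
  with A \<open>B \<subseteq> D\<close> show "B \<in> dual_on D Q"
    by (auto simp: dual_on_def)
qed

lemma dual_on_dual_on:
  assumes "quantifier_on D Q"
  shows "dual_on D (dual_on D Q) = Q"
  using assms by (auto simp: quantifier_on_def dual_on_def double_diff)

lemma branching_subset_iteration:
  assumes "quantifier_on D Q" "upward_monotone_on D P" "upward_monotone_on D Q"
    and "quantifier_on D P"
  shows "branching_on D P Q \<subseteq> iteration_on D P Q"
proof
  fix R
  assume "R \<in> branching_on D P Q"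
  then obtain A B where R: "R \<subseteq> D \<times> D" and AB: "A \<in> P" "B \<in> Q" "A \<times> B \<subseteq> R"
    by (auto simp: branching_on_def)
  have "A \<subseteq> D" "B \<subseteq> D"
    using assms AB by (auto simp: quantifier_on_def)
  have "section_at D R x \<in> Q" if "x \<in> A" for x
  proof -
    have "B \<subseteq> section_at D R x" "section_at D R x \<subseteq> D"
      using that AB(3) \<open>B \<subseteq> D\<close> by (auto simp: section_at_def)
    with AB(2) assms(3) show ?thesis
      unfolding upward_monotone_on_def by blast
  qed
  with \<open>A \<subseteq> D\<close> have "A \<subseteq> {x \<in> D. section_at D R x \<in> Q}"
    by auto
  moreover have "{x \<in> D. section_at D R x \<in> Q} \<subseteq> D"
    by auto
  ultimately have "{x \<in> D. section_at D R x \<in> Q} \<in> P"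
    using AB(1) assms(2) unfolding upward_monotone_on_def by blast
  with R show "R \<in> iteration_on D P Q"
    by (simp add: iteration_on_def)
qed

lemma iteration_subset_branching:
  assumes "small \<kappa> P" "complete_on D \<kappa> Q"
  shows "iteration_on D P Q \<subseteq> branching_on D P Q"
proof
  fix R
  assume "R \<in> iteration_on D P Q"
  then have R: "R \<subseteq> D \<times> D" and "{x \<in> D. section_at D R x \<in> Q} \<in> P"
    by (auto simp: iteration_on_def)
  with assms(1) obtain A where A: "A \<in> P" "A \<subseteq> {x \<in> D. section_at D R x \<in> Q}" "|A| <o \<kappa>"
    unfolding small_def by blast
  let ?B = "D \<inter> \<Inter>(section_at D R ` A)"
  have "|section_at D R ` A| <o \<kappa>"
    using card_of_image A(3) by (rule ordLeq_ordLess_trans)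
  moreover have "section_at D R ` A \<subseteq> Q"
    using A(2) by auto
  ultimately have "?B \<in> Q"
    using assms(2) unfolding complete_on_def by blast
  moreover have "A \<times> ?B \<subseteq> R"
    by (auto simp: section_at_def)
  ultimately show "R \<in> branching_on D P Q"
    using R A(1) unfolding branching_on_def by blast
qed

lemma iteration_eq_branching:
  assumes "quantifier_on D P" "upward_monotone_on D P"
    and "quantifier_on D Q" "upward_monotone_on D Q"
    and "small \<kappa> P" "complete_on D \<kappa> Q"
  shows "iteration_on D P Q = branching_on D P Q"
  using branching_subset_iteration iteration_subset_branching assms by (metis subset_antisym)

text \<open>
  An infinite cardinal is the union of \<open>cf(\<lambda>)\<close> proper initial segments. The index order is
  \<open>|C|\<close> for a cofinal set \<open>C\<close> of least cardinality, and this need not be the order that \<open>C\<close>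
  inherits from \<open>B\<close>. The segments below the elements of \<open>C\<close> may therefore fail to increase
  with the index and have to be accumulated. The accumulated sets remain small because fewer
  than \<open>|C|\<close> elements of \<open>B\<close> are never cofinal.
\<close>

lemma cofinality_chain:
  fixes B :: "'a set"
  assumes "Cinfinite |B|"
  obtains U where "\<And>\<alpha> \<beta>. (\<alpha>, \<beta>) \<in> cofinality |B| \<Longrightarrow> U \<alpha> \<subseteq> U \<beta>"
    and "\<And>\<alpha>. \<alpha> \<in> Field (cofinality |B| ) \<Longrightarrow> |U \<alpha>| <o |B|"
    and "(\<Union>\<alpha> \<in> Field (cofinality |B| ). U \<alpha>) = B"
proof -
  note Field_card_of [simp]
  obtain C where C: "C \<subseteq> Field |B|" "cofinal C |B|" "cofinality |B| = |C|"
    and min: "\<And>C'. C' \<subseteq> Field |B| \<Longrightarrow> cofinal C' |B| \<Longrightarrow> |C| \<le>o |C'|"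
    by (rule cofinality_witness[OF assms]) (rule that)
  have wB: "Well_order |B|" and wC: "Well_order |C|"
    by (rule card_of_Well_order)+
  have tC: "trans |C|" and rC: "refl_on C |C|"
    using wC by (auto simp: order_on_defs)
  have tB: "trans |B|" and aB: "antisym |B|" and toB: "total_on B |B|" and rB: "refl_on B |B|"
    using wB by (auto simp: order_on_defs)
  define U where "U \<alpha> = (\<Union>c \<in> under |C| \<alpha>. underS |B| c)" for \<alpha>
  have mono: "U \<alpha> \<subseteq> U \<beta>" if "(\<alpha>, \<beta>) \<in> |C|" for \<alpha> \<beta>
    using that under_incr[OF tC] by (auto simp: U_def)
  have card: "|U \<alpha>| <o |B|" if \<alpha>: "\<alpha> \<in> C" for \<alpha>
  proof -
    have "underS |C| \<alpha> \<subseteq> C"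
      using underS_Field[of _ "|C|" \<alpha>] by auto
    moreover have "|underS |C| \<alpha>| <o |C|"
      using card_of_underS[OF card_of_Card_order] \<alpha> by simp
    ultimately have "\<not> cofinal (underS |C| \<alpha>) |B|"
      using min[of "underS |C| \<alpha>"] C(1) not_ordLess_ordLeq[of "|underS |C| \<alpha>|" "|C|"] by auto
    then obtain b where b: "b \<in> B"
      and nb: "\<And>c. c \<in> underS |C| \<alpha> \<Longrightarrow> b = c \<or> (b, c) \<notin> |B|"
      by (auto simp: cofinal_def)
    have le: "(c, b) \<in> |B|" if "c \<in> underS |C| \<alpha>" for c
    proof -
      have "c \<in> B" using that \<open>underS |C| \<alpha> \<subseteq> C\<close> C(1) by auto
      with nb[OF that] b toB rB show ?thesis
        unfolding total_on_def refl_on_def Field_card_of by metis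
    qed
    \<comment> \<open>\<open>b\<close> bounds only the indices strictly below \<open>\<alpha>\<close>; the larger of \<open>b\<close> and \<open>\<alpha>\<close> bounds them all.\<close>
    have "\<alpha> \<in> B" using \<alpha> C(1) by auto
    then obtain m where m: "m \<in> B" "(b, m) \<in> |B|" "(\<alpha>, m) \<in> |B|"
      using b toB rB unfolding total_on_def refl_on_def Field_card_of by metis
    have "(c, m) \<in> |B|" if "c \<in> under |C| \<alpha>" for c
    proof (cases "c = \<alpha>")
      case False
      with that have "c \<in> underS |C| \<alpha>"
        by (auto simp: under_def underS_def)
      with m(2) show ?thesis
        using transD[OF tB le] by simp
    qed (use m in simp)
    then have "U \<alpha> \<subseteq> underS |B| m"
      using underS_incr[OF tB aB] by (auto simp: U_def)
    moreover have "|underS |B| m| <o |B|"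
      using card_of_underS[OF card_of_Card_order] m(1) by simp
    ultimately show ?thesis
      by (rule ordLeq_ordLess_trans[OF card_of_mono1])
  qed
  have "(\<Union>\<alpha> \<in> C. U \<alpha>) = B"
  proof
    show "(\<Union>\<alpha> \<in> C. U \<alpha>) \<subseteq> B"
      using underS_Field[of _ "|B|"] by (auto simp: U_def)
    show "B \<subseteq> (\<Union>\<alpha> \<in> C. U \<alpha>)"
    proof
      fix b
      assume "b \<in> B"
      with C(2) obtain c where "c \<in> C" "b \<noteq> c" "(b, c) \<in> |B|"
        by (auto simp: cofinal_def)
      then show "b \<in> (\<Union>\<alpha> \<in> C. U \<alpha>)"
        using rC by (auto simp: U_def under_def underS_def refl_on_def)
    qed
  qed
  with mono card show thesis
    by (intro that[of U]) (simp_all add: C(3))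
qed

lemma small_dual_if_chain_complete:
  fixes D :: "'a set" and \<kappa> :: "'k rel"
  assumes "Cinfinite \<kappa>"
    and chain: "\<And>\<mu> :: 'a rel. Card_order \<mu> \<Longrightarrow> \<kappa> \<le>o \<mu> \<Longrightarrow> \<mu> \<le>o |D|
      \<Longrightarrow> chain_complete (cofinality \<mu>) Q"
  shows "small \<kappa> (dual_on D Q)"
  unfolding small_def
proof
  fix A
  assume A: "A \<in> dual_on D Q"
  let ?S = "card_of ` {B \<in> dual_on D Q. B \<subseteq> A}"
  have "?S \<noteq> {}"
    using A by auto
  moreover have "\<forall>s \<in> ?S. Card_order s"
    by (auto simp: card_of_Card_order)
  ultimately have "\<exists>s \<in> ?S. \<forall>s' \<in> ?S. s \<le>o s'"
    by (rule exists_minim_Card_order)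
  then obtain B where B: "B \<in> dual_on D Q" "B \<subseteq> A"
    and min: "\<And>B'. B' \<in> dual_on D Q \<Longrightarrow> B' \<subseteq> A \<Longrightarrow> |B| \<le>o |B'|"
    by auto
  have "B \<subseteq> D" "D - B \<notin> Q"
    using B(1) by (auto simp: dual_on_def)
  have "|B| <o \<kappa>"
  proof (rule ccontr)
    assume "\<not> |B| <o \<kappa>"
    then have le: "\<kappa> \<le>o |B|"
      using assms(1) card_of_Well_order[of B] card_order_on_well_order_on[of _ \<kappa>]
        not_ordLess_iff_ordLeq[of \<kappa> "|B|"]
      by simp
    have inf: "Cinfinite |B|"
      using cinfinite_mono[OF le] assms(1) card_of_Card_order[of B] by simp
    have cc: "chain_complete (cofinality |B| ) Q"
      using chain[OF card_of_Card_order le card_of_mono1[OF \<open>B \<subseteq> D\<close>]] .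
    obtain U where mono: "\<And>\<alpha> \<beta>. (\<alpha>, \<beta>) \<in> cofinality |B| \<Longrightarrow> U \<alpha> \<subseteq> U \<beta>"
      and card: "\<And>\<alpha>. \<alpha> \<in> Field (cofinality |B| ) \<Longrightarrow> |U \<alpha>| <o |B|"
      and un: "(\<Union>\<alpha> \<in> Field (cofinality |B| ). U \<alpha>) = B"
      by (rule cofinality_chain[OF inf]) (rule that)
    have "D - U \<alpha> \<in> Q" if \<alpha>: "\<alpha> \<in> Field (cofinality |B| )" for \<alpha>
    proof -
      have "U \<alpha> \<subseteq> B" using un \<alpha> by auto
      with card[OF \<alpha>] min[of "U \<alpha>"] \<open>B \<subseteq> A\<close> have "U \<alpha> \<notin> dual_on D Q"
        using not_ordLess_ordLeq by blast
      with \<open>U \<alpha> \<subseteq> B\<close> \<open>B \<subseteq> D\<close> show ?thesis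
        by (auto simp: dual_on_def)
    qed
    moreover have "D - U \<beta> \<subseteq> D - U \<alpha>" if "(\<alpha>, \<beta>) \<in> cofinality |B|" for \<alpha> \<beta>
      using mono[OF that] by auto
    ultimately have "(\<Inter>\<alpha> \<in> Field (cofinality |B| ). D - U \<alpha>) \<in> Q"
      using cc[unfolded chain_complete_def, rule_format, of "\<lambda>\<alpha>. D - U \<alpha>"] by blast
    \<comment> \<open>An intersection over an empty index set would be \<open>UNIV\<close> instead of \<open>D - B\<close>.\<close>
    moreover have "B \<noteq> {}"
      using inf by (auto simp: cinfinite_def Field_card_of)
    then have "(\<Inter>\<alpha> \<in> Field (cofinality |B| ). D - U \<alpha>) = D - B"
      using un by blast
    ultimately show False
      using \<open>D - B \<notin> Q\<close> by simp
  qed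
  with B show "\<exists>B \<in> dual_on D Q. B \<subseteq> A \<and> |B| <o \<kappa>"
    by blast
qed

theorem corollary5p2:
  fixes D :: "'a set" and P Q :: "'a set set" and \<kappa> :: "'k rel"
  assumes "D \<noteq> {}"
    and "quantifier_on D P" and "upward_monotone_on D P" and "proper_on D P"
    and "quantifier_on D Q" and "upward_monotone_on D Q" and "proper_on D Q"
    and "Cinfinite \<kappa>"
  shows "(small \<kappa> P \<and> complete_on D \<kappa> Q
            \<longrightarrow> iteration_on D P Q = branching_on D P Q)
       \<and> (small \<kappa> (dual_on D Q) \<and> complete_on D \<kappa> (dual_on D P)
            \<longrightarrow> iteration_on D (dual_on D Q) (dual_on D P)
              = branching_on D (dual_on D Q) (dual_on D P))
       \<and> ((\<forall>\<mu> :: 'a rel. Card_order \<mu> \<and> \<kappa> \<le>o \<mu> \<and> \<mu> \<le>o |D|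
              \<longrightarrow> chain_complete (cofinality \<mu>) Q)
            \<and> complete_on D \<kappa> (dual_on D P)
            \<longrightarrow> iteration_on D (dual_on D Q) (dual_on D P)
              = branching_on D (dual_on D Q) (dual_on D P))
       \<and> ((\<forall>\<mu> :: 'a rel. Card_order \<mu> \<and> \<kappa> \<le>o \<mu> \<and> \<mu> \<le>o |D|
              \<longrightarrow> chain_complete (cofinality \<mu>) (dual_on D P))
            \<and> complete_on D \<kappa> Q
            \<longrightarrow> iteration_on D P Q = branching_on D P Q)"
proof -
  note dualP = quantifier_on_dual[of D P] upward_monotone_on_dual[OF assms(3)]
  note dualQ = quantifier_on_dual[of D Q] upward_monotone_on_dual[OF assms(6)]
  have direct: "iteration_on D P Q = branching_on D P Q"
    if "small \<kappa> P" "complete_on D \<kappa> Q"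
    using iteration_eq_branching[OF assms(2,3,5,6) that] .
  have dual: "iteration_on D (dual_on D Q) (dual_on D P)
      = branching_on D (dual_on D Q) (dual_on D P)"
    if "small \<kappa> (dual_on D Q)" "complete_on D \<kappa> (dual_on D P)"
    using iteration_eq_branching[OF dualQ dualP that] .
  have smallQ: "small \<kappa> (dual_on D Q)"
    if "\<forall>\<mu> :: 'a rel. Card_order \<mu> \<and> \<kappa> \<le>o \<mu> \<and> \<mu> \<le>o |D|
      \<longrightarrow> chain_complete (cofinality \<mu>) Q"
    using small_dual_if_chain_complete[OF assms(8)] that by blast
  have smallP: "small \<kappa> P"
    if "\<forall>\<mu> :: 'a rel. Card_order \<mu> \<and> \<kappa> \<le>o \<mu> \<and> \<mu> \<le>o |D|
      \<longrightarrow> chain_complete (cofinality \<mu>) (dual_on D P)"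
    using small_dual_if_chain_complete[OF assms(8), of D "dual_on D P"] that
    by (simp add: dual_on_dual_on[OF assms(2)])
  show ?thesis
    by (intro conjI impI; elim conjE) (simp_all add: direct dual smallQ smallP)
qed

end
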